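(* Let $G=\mathbb{R}^3=\{(x,y,z)\}$ be the Heisenberg group with the left-invariant vector fields $$X_1=\frac{\partial}{\partial x}-\frac y2\frac{\partial}{\partial z},\qquad X_2=\frac{\partial}{\partial y}+\frac x2\frac{\partial}{\partial z},\qquad X_3=\frac{\partial}{\partial z},$$ and consider the control system $$\dot q=\sum_{i=1}^3u_iX_i(q),\qquad q=(x,y,z)\in G,$$ $$u\in U=\{(u_1,u_2,u_3)\in\mathbb{R}^3\mid -u_1^2+u_2^2+u_3^2\le 0,\ u_1\ge 0\}.$$ The attainable set $\mathcal{A}_{q_0}$ of this system from the point $q_0=(0,0,0)$ for arbitrary nonnegative time is $$\mathcal{A}_{q_0}=\Big\{(x,y,z)\in G\ \Big|\ 0<|z|\le\frac{t+\sinh t}{2},\ t=\operatorname{arcosh}\frac{x^2-y^2+2}{2}\Big\}\cup\{(x,y,z)\in G\mid x\ge|y|,\ z=0\}.$$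
   Context: In coordinates the system is $\dot x=u_1$, $\dot y=u_2$, $\dot z=-\frac y2u_1+\frac x2u_2+u_3$. An admissible trajectory is a Lipschitz curve $q:[0,t_1]\to G$, $t_1\ge 0$, satisfying $\dot q(t)=\sum_{i=1}^3u_i(t)X_i(q(t))$ for almost every $t$, with a measurable essentially bounded control $u:[0,t_1]\to U$. The attainable set $\mathcal{A}_{q_0}$ from $q_0$ for arbitrary nonnegative time is the set of all endpoints $q(t_1)$ of admissible trajectories with $q(0)=q_0$, over all $t_1\ge 0$. Here $\operatorname{arcosh}:[1,\infty)\to[0,\infty)$ is the inverse of the hyperbolic cosine.
   Formalization: The condition x ≥ 0 is added to the first set: its formula depends on x only via x², so as printed it contains e.g. (−1,0,1/2), which is not attainable since u₁ ≥ 0 makes x nondecreasing; the domain condition (x²−y²+2)/2 ≥ 1 of arcosh is also written out. *)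

theory Defs
  imports "HOL-Analysis.Analysis"
begin

type_synonym point = "real \<times> real \<times> real"

definition X1 :: "point \<Rightarrow> point" where
  "X1 = (\<lambda>(x, y, z). (1, 0, - y / 2))"

definition X2 :: "point \<Rightarrow> point" where
  "X2 = (\<lambda>(x, y, z). (0, 1, x / 2))"

definition X3 :: "point \<Rightarrow> point" where
  "X3 = (\<lambda>(x, y, z). (0, 0, 1))"

definition control_field :: "point \<Rightarrow> point \<Rightarrow> point" where
  "control_field = (\<lambda>(u1, u2, u3) q. u1 *\<^sub>R X1 q + u2 *\<^sub>R X2 q + u3 *\<^sub>R X3 q)"

definition U :: "point set" where
  "U = {(u1, u2, u3). - u1\<^sup>2 + u2\<^sup>2 + u3\<^sup>2 \<le> 0 \<and> u1 \<ge> 0}"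

text \<open>Values of \<open>u\<close> and \<open>q\<close> outside \<open>{0..t1}\<close> are irrelevant. Measurability and
  ``almost every'' refer to Lebesgue measure on \<open>{0..t1}\<close>.\<close>

definition admissible_control :: "real \<Rightarrow> (real \<Rightarrow> point) \<Rightarrow> bool" where
  "admissible_control t1 u \<longleftrightarrow>
     u \<in> borel_measurable (lebesgue_on {0..t1}) \<and>
     (\<forall>t\<in>{0..t1}. u t \<in> U) \<and>
     (\<exists>M. AE t in lebesgue_on {0..t1}. norm (u t) \<le> M)"

definition admissible_trajectory :: "real \<Rightarrow> (real \<Rightarrow> point) \<Rightarrow> bool" where
  "admissible_trajectory t1 q \<longleftrightarrow>
     t1 \<ge> 0 \<and>
     (\<exists>L. L-lipschitz_on {0..t1} q) \<and>
     (\<exists>u. admissible_control t1 u \<and>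
        (AE t in lebesgue_on {0..t1}.
           (q has_vector_derivative control_field (u t) (q t)) (at t within {0..t1})))"

definition attainable_set :: "point \<Rightarrow> point set" where
  "attainable_set q0 = {q t1 | q t1. admissible_trajectory t1 q \<and> q 0 = q0}"

text \<open>In the description of the attainable set from the origin, the condition
  \<open>1 \<le> (x\<^sup>2 - y\<^sup>2 + 2) / 2\<close> is the domain of \<open>arcosh\<close>, which the formula leaves tacit
  (in HOL \<open>arcosh\<close> is total). The condition \<open>0 \<le> x\<close> is tacit too: the formula depends on
  \<open>x\<close> only through \<open>x\<^sup>2\<close>, while \<open>u1 \<ge> 0\<close> makes \<open>x\<close> nondecreasing along
  trajectories, so points such as \<open>(-1, 0, 1/2)\<close> are not attainable from the origin.\<close>

end

(* In projection to the (x, y)-plane, trajectories are causal curves of the Minkowski metric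
   dx^2 - dy^2, and z is the swept area plus the integral of u3, where |u3| is at most the
   Lorentzian speed. In hyperbolic polar coordinates x = r cosh(phi), y = r sinh(phi) one has
   dz = (r^2/2) dphi + u3 dt with (r dphi)^2 + (u3 dt)^2 <= dr^2, so Cauchy-Schwarz gives
   |dz| <= sqrt(1 + r^2/4) dr, and |z| <= zmax(r^2) := the integral of the right-hand side.
   At r = 0 polar coordinates break down and zmax(x^2 - y^2) is not Lipschitz, hence the estimate
   is made for a trajectory translated from the origin to (eps, 0, 0), with eps -> 0 at the end.

   Conversely, the segment from the origin reaches all |z| <= r, and the hyperbolic arcs from the
   origin to (x, y) with u3 = +-1 reach the rest: with growing curvature the height runs
   continuously from r to zmax(r^2). *)
theory Submission
  imports Defs "HOL-Real_Asymp.Real_Asymp"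
begin

section \<open>Monotonicity of Lipschitz functions with almost everywhere nonnegative
  derivative\<close>

(* Cover the exceptional set N by an open set T of small measure. Adding L |T \<inter> {a..t}| + e t to f
   makes it locally nondecreasing at every point: on T by the Lipschitz bound, off N by the
   derivative. *)
lemma lipschitz_ae_nonneg_deriv_le:
  fixes f :: "real \<Rightarrow> real"
  assumes "a \<le> b" and lip: "L-lipschitz_on {a..b} f" and N: "negligible N"
    and deriv: "\<And>t. t \<in> {a..b} - N \<Longrightarrow>
      \<exists>D\<ge>0. (f has_vector_derivative D) (at t within {a..b})"
  shows "f a \<le> f b"
proof (rule field_le_epsilon)
  fix \<epsilon> :: real
  assume "\<epsilon> > 0"
  \<comment> \<open>The total correction between \<open>a\<close> and \<open>b\<close> is at most
    \<open>L * e + e * (b - a)\<close>, which this choice keeps below \<open>\<epsilon>\<close>; the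
    summand 1 makes the denominator positive.\<close>
  define e where "e = \<epsilon> / (L + (b - a) + 1)"
  have L: "L \<ge> 0" using lip by (rule lipschitz_on_nonneg)
  have den: "L + (b - a) + 1 > 0" using L \<open>a \<le> b\<close> by linarith
  have e: "e > 0" unfolding e_def using den \<open>\<epsilon> > 0\<close> by simp
  have N0: "N \<in> null_sets lebesgue" using N by (simp add: negligible_iff_null_sets)
  obtain T where T: "open T" "N \<subseteq> T" "T - N \<in> lmeasurable"
      "emeasure lebesgue (T - N) < ennreal e"
    using sets_lebesgue_outer_open[OF _ e, of N] N0 by blast
  have Tm: "T \<in> sets lebesgue" using T(1) by simp
  have "emeasure lebesgue T = emeasure lebesgue (T - N)"
    using emeasure_Diff_null_set[OF N0 Tm] by simp
  then have emT: "emeasure lebesgue T < ennreal e" using T(4) by simp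
  have Tlm: "T \<in> lmeasurable"
    using emT Tm by (intro fmeasurableI) (auto intro: order_less_trans)
  have mT: "measure lebesgue T \<le> e"
    using emT e by (simp add: measure_def enn2real_leI less_imp_le)
  define w where "w t = measure lebesgue (T \<inter> {a..t})" for t
  have lm: "T \<inter> {s..t} \<in> lmeasurable" "T \<inter> {s<..t} \<in> lmeasurable" for s t
    using Tlm by (auto intro: fmeasurable_Int_fmeasurable)
  have w_diff: "w t - w s = measure lebesgue (T \<inter> {s<..t})" if "a \<le> s" "s \<le> t" for s t
  proof -
    have "T \<inter> {a..t} = (T \<inter> {a..s}) \<union> (T \<inter> {s<..t})" using that by auto
    then have "w t = measure lebesgue ((T \<inter> {a..s}) \<union> (T \<inter> {s<..t}))" by (simp add: w_def)
    also have "\<dots> = w s + measure lebesgue (T \<inter> {s<..t})"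
    proof -
      have "T \<inter> {a..s} \<inter> (T \<inter> {s<..t}) = {}" by auto
      then show ?thesis unfolding w_def using lm by (simp add: measure_Un3)
    qed
    finally show ?thesis by simp
  qed
  define g where "g t = f t + L * w t + e * t" for t
  \<comment> \<open>The bounds sit inside the predicate because the small intervals around
    \<open>x\<close> in \<open>Bolzano\<close> may leave \<open>{a..b}\<close>. It suffices to
    compare \<open>g\<close> at points on either side of \<open>x\<close>.\<close>
  have "a \<le> a \<longrightarrow> b \<le> b \<longrightarrow> g a \<le> g b"
    using \<open>a \<le> b\<close>
  proof (induction rule: Bolzano[where P = "\<lambda>s t. a \<le> s \<longrightarrow> t \<le> b \<longrightarrow> g s \<le> g t"])
    case (trans s t u)
    then show ?case by auto
  next
    case (local x)
    show ?case
    proof (cases "x \<in> N")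
      case True
      then obtain d where d: "d > 0" "ball x d \<subseteq> T" using T(1,2) open_contains_ball by blast
      have "g s \<le> g t" if st: "s \<le> x" "x \<le> t" "t - s < d" "a \<le> s" "t \<le> b" for s t
      proof -
        have "{s<..t} \<subseteq> ball x d" using st by (auto simp: dist_real_def)
        then have "T \<inter> {s<..t} = {s<..t}" using d by blast
        then have "w t - w s = t - s" using w_diff[of s t] st by simp
        moreover have "dist (f s) (f t) \<le> L * dist s t"
          using lip st by (intro lipschitz_onD) auto
        then have "f s - f t \<le> L * (t - s)" using st by (simp add: dist_real_def)
        moreover have "e * s \<le> e * t" using st e by simp
        ultimately show ?thesis unfolding g_def
          by (smt (verit) right_diff_distrib)
      qed
      then show ?thesis using d(1) by blast
    next
      case False
      then obtain D where D: "D \<ge> 0" "(f has_vector_derivative D) (at x within {a..b})"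
        using deriv[of x] local by auto
      then obtain d where d: "d > 0" "\<And>y. y \<in> {a..b} \<Longrightarrow> norm (y - x) < d \<Longrightarrow>
          norm (f y - f x - (y - x) * D) \<le> e * norm (y - x)"
        using e unfolding has_vector_derivative_def has_derivative_within_alt by force
      have "g s \<le> g t" if st: "s \<le> x" "x \<le> t" "t - s < d" "a \<le> s" "t \<le> b" for s t
      proof -
        have "\<bar>f t - f x - (t - x) * D\<bar> \<le> e * (t - x)" using d(2)[of t] st by auto
        moreover have "\<bar>f s - f x - (s - x) * D\<bar> \<le> e * (x - s)"
          using d(2)[of s] st by (auto simp: abs_minus_commute)
        moreover have "(t - x) * D \<ge> 0" "(s - x) * D \<le> 0"
          using st D(1) by (auto simp: mult_nonpos_nonneg)
        moreover have "L * w s \<le> L * w t"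
          using w_diff[of s t] st L by (intro mult_left_mono) (smt (verit) measure_nonneg, auto)
        ultimately show ?thesis unfolding g_def by (auto simp: algebra_simps abs_le_iff)
      qed
      then show ?thesis using d(1) by blast
    qed
  qed
  then have "f a + L * w a + e * a \<le> f b + L * w b + e * b" by (simp add: g_def)
  moreover have "L * w a \<ge> 0" using L by (simp add: w_def)
  moreover have "w b \<le> e"
    using mT measure_mono_fmeasurable[of "T \<inter> {a..b}" T lebesgue] lm(1)[of a b] Tlm
    unfolding w_def by (auto dest: fmeasurableD)
  then have "L * w b \<le> L * e" using L by (rule mult_left_mono)
  moreover have "e * (L + (b - a) + 1) = \<epsilon>"
    using den unfolding e_def by simp
  ultimately show "f a \<le> f b + \<epsilon>" using e by (simp add: algebra_simps)
qed

section \<open>The extremal height \<open>zmax\<close> and Lipschitz estimates\<close>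

text \<open>Closed form of the integral of \<open>sqrt (1 + s\<^sup>2 / 4)\<close> over
  \<open>s\<close> from 0 to \<open>sqrt \<rho>\<close>. Taking the squared radius as argument keeps
  \<open>\<rho>\<close> polynomial in the coordinates.\<close>

definition zmax :: "real \<Rightarrow> real" where
  "zmax \<rho> = arsinh (sqrt \<rho> / 2) + sqrt \<rho> / 2 * sqrt (1 + \<rho> / 4)"

lemma zmax_nonneg:
  assumes "0 \<le> \<rho>"
  shows "0 \<le> zmax \<rho>"
proof -
  have "0 \<le> arsinh (sqrt \<rho> / 2)"
    using assms arsinh_real_pos_iff[of "sqrt \<rho> / 2"] by (cases "\<rho> = 0") (auto intro: less_imp_le)
  then show ?thesis using assms by (simp add: zmax_def)
qed

lemma zmax_has_real_derivative:
  assumes "\<rho> > 0"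
  shows "(zmax has_real_derivative sqrt (1 + \<rho> / 4) / (2 * sqrt \<rho>)) (at \<rho> within A)"
proof -
  define a b where "a = sqrt \<rho>" and "b = sqrt (1 + \<rho> / 4)"
  have a: "a > 0" "\<rho> = a\<^sup>2" and b: "b > 0" "b\<^sup>2 = 1 + a\<^sup>2 / 4" 
    using assms by (auto simp: a_def b_def)
  have s: "sqrt ((sqrt \<rho> / 2)\<^sup>2 + 1) = b"
    using assms by (simp add: b_def power_divide add.commute)
  have "(zmax has_real_derivative
      1 / b * (1 / (2 * a) / 2) + ((1 / (2 * a) / 2) * b + a / 2 * (1 / 4 * (1 / (2 * b))))) (at \<rho> within A)"
    unfolding zmax_def[abs_def]
  proof (rule DERIV_add)
    have "(arsinh has_real_derivative 1 / b) (at (sqrt \<rho> / 2))"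
      using arsinh_real_has_field_derivative[of "sqrt \<rho> / 2" UNIV] s by simp
    moreover have "((\<lambda>\<rho>. sqrt \<rho> / 2) has_real_derivative 1 / (2 * a) / 2) (at \<rho> within A)"
      using assms by (auto intro!: derivative_eq_intros simp: a_def field_simps)
    ultimately show "((\<lambda>\<rho>. arsinh (sqrt \<rho> / 2)) has_real_derivative 1 / b * (1 / (2 * a) / 2)) (at \<rho> within A)"
      by (rule DERIV_chain2)
    show "((\<lambda>\<rho>. sqrt \<rho> / 2 * sqrt (1 + \<rho> / 4)) has_real_derivative
        (1 / (2 * a) / 2) * b + a / 2 * (1 / 4 * (1 / (2 * b)))) (at \<rho> within A)"
      using assms by (auto intro!: derivative_eq_intros simp: a_def b_def field_simps)
  qed
  also have "1 / b * (1 / (2 * a) / 2) + ((1 / (2 * a) / 2) * b + a / 2 * (1 / 4 * (1 / (2 * b)))) = b / (2 * a)"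
  proof -
    \<comment> \<open>With \<open>a\<^sup>2 = 4 * b\<^sup>2 - 4\<close> the numerator over the
      common denominator collapses to a single term.\<close>
    have "4 + 4 * b\<^sup>2 + a\<^sup>2 = 8 * b\<^sup>2" using b by simp
    then have "(4 + 4 * b\<^sup>2 + a\<^sup>2) / (16 * (a * b)) = 8 * b\<^sup>2 / (16 * (a * b))" by (simp only:)
    also have "\<dots> = b / (2 * a)"
      using a b(1) by (simp add: field_simps power2_eq_square)
    finally have "(4 + 4 * b\<^sup>2 + a\<^sup>2) / (16 * (a * b)) = b / (2 * a)" .
    moreover have "1 / b * (1 / (2 * a) / 2) + ((1 / (2 * a) / 2) * b + a / 2 * (1 / 4 * (1 / (2 * b))))
        = (4 + 4 * b\<^sup>2 + a\<^sup>2) / (16 * (a * b))"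
      using a b(1) by (simp add: field_simps power2_eq_square)
    ultimately show ?thesis by simp
  qed
  finally show ?thesis by (simp add: a_def b_def)
qed

text \<open>Serves for \<open>\<rho>\<close>, which factors into two Lipschitz functions bounded on
  a compact time interval.\<close>

lemma lipschitz_on_mult:
  fixes f g :: "'a::metric_space \<Rightarrow> real"
  assumes "L-lipschitz_on S f" "M-lipschitz_on S g"
    and "bounded (f ` S)" "bounded (g ` S)"
  obtains K where "K-lipschitz_on S (\<lambda>x. f x * g x)"
proof -
  obtain B where B: "B > 0" "\<And>x. x \<in> S \<Longrightarrow> \<bar>f x\<bar> \<le> B"
    using assms(3) by (auto simp: bounded_pos)
  obtain C where C: "C > 0" "\<And>x. x \<in> S \<Longrightarrow> \<bar>g x\<bar> \<le> C"
    using assms(4) by (auto simp: bounded_pos)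
  have "(L * C + B * M)-lipschitz_on S (\<lambda>x. f x * g x)"
  proof (rule lipschitz_onI)
    fix x y assume xy: "x \<in> S" "y \<in> S"
    have "dist (f x * g x) (f y * g y) = \<bar>(f x - f y) * g x + f y * (g x - g y)\<bar>"
      by (simp add: dist_real_def algebra_simps)
    also have "\<dots> \<le> \<bar>f x - f y\<bar> * \<bar>g x\<bar> + \<bar>f y\<bar> * \<bar>g x - g y\<bar>"
      by (metis abs_mult abs_triangle_ineq)
    also have "\<dots> \<le> (L * dist x y) * C + B * (M * dist x y)"
      using xy B C lipschitz_onD[OF assms(1) xy] lipschitz_onD[OF assms(2) xy]
      by (intro add_mono mult_mono) (auto simp: dist_real_def)
    finally show "dist (f x * g x) (f y * g y) \<le> (L * C + B * M) * dist x y"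
      by (simp add: algebra_simps)
  qed (use B C assms(1,2) lipschitz_on_nonneg in \<open>auto intro!: add_nonneg_nonneg mult_nonneg_nonneg simp: less_imp_le\<close>)
  then show ?thesis by (rule that)
qed

text \<open>The squared derivative is \<open>1 / (4 * \<rho>) + 1 / 16\<close>, which decreases in
  \<open>\<rho>\<close>, so its value at \<open>\<delta>\<close> bounds it. The constant blows up as
  \<open>\<delta>\<close> tends to 0.\<close>

lemma zmax_lipschitz_on:
  assumes "\<delta> > 0"
  shows "(sqrt (1 / (4 * \<delta>) + 1 / 16))-lipschitz_on {\<delta>..} zmax"
proof (rule bounded_derivative_imp_lipschitz)
  fix \<rho> assume \<rho>: "\<rho> \<in> {\<delta>..}"
  show "(zmax has_derivative (*) (sqrt (1 + \<rho> / 4) / (2 * sqrt \<rho>))) (at \<rho> within {\<delta>..})"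
    using zmax_has_real_derivative[of \<rho> "{\<delta>..}"] \<rho> assms by (simp add: has_field_derivative_def)
  have "sqrt (1 + \<rho> / 4) / (2 * sqrt \<rho>) = sqrt ((1 + \<rho> / 4) / (4 * \<rho>))"
    by (simp add: real_sqrt_divide real_sqrt_mult)
  also have "(1 + \<rho> / 4) / (4 * \<rho>) = 1 / (4 * \<rho>) + 1 / 16"
    using \<rho> assms by (simp add: field_simps)
  also have "sqrt \<dots> \<le> sqrt (1 / (4 * \<delta>) + 1 / 16)"
    using \<rho> assms by (simp add: frac_le)
  finally show "onorm ((*) (sqrt (1 + \<rho> / 4) / (2 * sqrt \<rho>))) \<le> sqrt (1 / (4 * \<delta>) + 1 / 16)"
    using \<rho> assms by (intro onorm_le, subst norm_mult, intro mult_right_mono) auto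
qed (use assms in auto)

section \<open>Necessity: bounds on the endpoints of trajectories\<close>

text \<open>The infinitesimal form of the height bound: on the left stands \<open>\<sigma>\<close>
  times the velocity of \<open>z\<close>, on the right the derivative of \<open>zmax\<close> at
  \<open>\<rho>\<close> times the velocity of \<open>\<rho>\<close>.\<close>

lemma hyperbolic_cauchy_schwarz:
  fixes x y u1 u2 u3 \<rho> :: real
  assumes \<rho>: "\<rho> = x\<^sup>2 - y\<^sup>2" "\<rho> > 0" and "\<bar>y\<bar> \<le> x" and u: "u2\<^sup>2 + u3\<^sup>2 \<le> u1\<^sup>2" "0 \<le> u1"
    and \<sigma>: "\<bar>\<sigma>\<bar> = 1"
  shows "\<sigma> * ((x * u2 - y * u1) / 2 + u3) \<le> sqrt (1 + \<rho> / 4) / (2 * sqrt \<rho>) * (2 * (x * u1 - y * u2))"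
proof -
  define p q where "p = x * u2 - y * u1" and "q = x * u1 - y * u2"
  have "u2\<^sup>2 \<le> u1\<^sup>2" using u(1) by (smt (verit) zero_le_power2)
  then have "\<bar>u2\<bar> \<le> u1" using u(2) by (simp add: abs_le_square_iff[symmetric])
  \<comment> \<open>\<open>q\<close> is the Minkowski product of \<open>(x, y)\<close> and
    \<open>(u1, u2)\<close>, both in the closed future cone.\<close>
  then have q0: "q \<ge> 0" unfolding q_def
    using mult_mono[of "\<bar>y\<bar>" x "\<bar>u2\<bar>" u1] assms(3) order_trans[OF abs_ge_zero assms(3)] abs_ge_self[of "y * u2"]
    by (simp add: abs_mult)
  \<comment> \<open>Lagrange identity for the Minkowski form.\<close>
  have "q\<^sup>2 - p\<^sup>2 = \<rho> * (u1\<^sup>2 - u2\<^sup>2)"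
    unfolding p_def q_def \<rho>(1) by (simp add: power2_eq_square algebra_simps)
  moreover have "\<rho> * u3\<^sup>2 \<le> \<rho> * (u1\<^sup>2 - u2\<^sup>2)" using \<rho>(2) u by (intro mult_left_mono) auto
  ultimately have q2: "p\<^sup>2 + \<rho> * u3\<^sup>2 \<le> q\<^sup>2" by linarith
  \<comment> \<open>Cauchy-Schwarz with its remainder written as an explicit square.\<close>
  have "4 * (\<rho> * (p / 2 + u3)\<^sup>2) + (2 * p - \<rho> * u3)\<^sup>2 = (4 + \<rho>) * (p\<^sup>2 + \<rho> * u3\<^sup>2)"
    by (simp add: power2_eq_square algebra_simps)
  have "\<rho> * (p / 2 + u3)\<^sup>2 \<le> (1 + \<rho> / 4) * (p\<^sup>2 + \<rho> * u3\<^sup>2)"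
  proof -
    have "(1 + \<rho> / 4) * (p\<^sup>2 + \<rho> * u3\<^sup>2) = (4 + \<rho>) * (p\<^sup>2 + \<rho> * u3\<^sup>2) / 4"
      by (simp add: field_simps)
    then show ?thesis
      using \<open>4 * _ + _ = _\<close> zero_le_power2[of "2 * p - \<rho> * u3"] by linarith
  qed
  also have "\<dots> \<le> (1 + \<rho> / 4) * q\<^sup>2" using q2 \<rho>(2) by (intro mult_left_mono) auto
  finally have "sqrt (\<rho> * (p / 2 + u3)\<^sup>2) \<le> sqrt ((1 + \<rho> / 4) * q\<^sup>2)" by simp
  then have "sqrt \<rho> * \<bar>p / 2 + u3\<bar> \<le> sqrt (1 + \<rho> / 4) * q"
    using q0 by (simp add: real_sqrt_mult)
  then have "\<bar>p / 2 + u3\<bar> \<le> sqrt (1 + \<rho> / 4) * q / sqrt \<rho>"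
    using \<rho>(2) by (simp add: field_simps)
  moreover have "\<sigma> * (p / 2 + u3) \<le> \<bar>p / 2 + u3\<bar>"
    using \<sigma> by (metis abs_ge_self abs_mult mult_1)
  ultimately show ?thesis unfolding p_def[symmetric] q_def[symmetric] by simp
qed

lemma control_field_eq:
  "control_field (u1, u2, u3) (x, y, z) = (u1, u2, u1 * (- y / 2) + u2 * (x / 2) + u3)"
  by (simp add: control_field_def X1_def X2_def X3_def)

lemma mem_U_iff: "(u1, u2, u3) \<in> U \<longleftrightarrow> u2\<^sup>2 + u3\<^sup>2 \<le> u1\<^sup>2 \<and> 0 \<le> u1"
  by (auto simp: U_def)

lemma admissible_trajectory_components:
  assumes "admissible_trajectory T q"
  obtains L N u1 u2 u3 where
    "L-lipschitz_on {0..T} q" "negligible N"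
    "\<And>t. t \<in> {0..T} \<Longrightarrow> (u1 t, u2 t, u3 t) \<in> U"
    "\<And>t. t \<in> {0..T} - N \<Longrightarrow>
       (q has_vector_derivative control_field (u1 t, u2 t, u3 t) (q t)) (at t within {0..T})"
proof -
  obtain L u where L: "L-lipschitz_on {0..T} q" and u: "admissible_control T u"
    and ae: "AE t in lebesgue_on {0..T}.
           (q has_vector_derivative control_field (u t) (q t)) (at t within {0..T})"
    using assms unfolding admissible_trajectory_def by blast
  obtain N where "N \<in> null_sets (lebesgue_on {0..T})"
    and N: "{t \<in> space (lebesgue_on {0..T}). \<not> (q has_vector_derivative control_field (u t) (q t)) (at t within {0..T})} \<subseteq> N"
    using ae unfolding eventually_ae_filter by blast
  then have "negligible N" by (simp add: null_sets_restrict_space negligible_iff_null_sets)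
  with L N u show ?thesis
    by (intro that[of L N "\<lambda>t. fst (u t)" "\<lambda>t. fst (snd (u t))" "\<lambda>t. snd (snd (u t))"])
      (auto simp: admissible_control_def)
qed

lemma attainable_from_origin_bounds:
  assumes "admissible_trajectory T q" "q 0 = (0, 0, 0)" "q T = (x1, y1, z1)"
  shows "\<bar>y1\<bar> \<le> x1" and "\<bar>z1\<bar> \<le> zmax (x1\<^sup>2 - y1\<^sup>2)"
proof -
  have T: "0 \<le> T" using assms(1) by (simp add: admissible_trajectory_def)
  obtain L N u1 u2 u3 where lip: "L-lipschitz_on {0..T} q" and N: "negligible N"
    and u: "\<And>t. t \<in> {0..T} \<Longrightarrow> (u1 t, u2 t, u3 t) \<in> U"
    and deriv: "\<And>t. t \<in> {0..T} - N \<Longrightarrow>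
       (q has_vector_derivative control_field (u1 t, u2 t, u3 t) (q t)) (at t within {0..T})"
    using admissible_trajectory_components[OF assms(1)] by metis
  define x y z where "x t = fst (q t)" and "y t = fst (snd (q t))" and "z t = snd (snd (q t))" for t
  have q: "q t = (x t, y t, z t)" for t by (simp add: x_def y_def z_def)
  have dq: "(q has_vector_derivative (u1 t, u2 t, u1 t * (- y t / 2) + u2 t * (x t / 2) + u3 t))
      (at t within {0..T})" if "t \<in> {0..T} - N" for t
    using deriv[OF that] by (simp only: q control_field_eq)
  have dx: "(x has_real_derivative u1 t) (at t within {0..T})"
    and dy: "(y has_real_derivative u2 t) (at t within {0..T})"
    and dz: "(z has_real_derivative (u1 t * (- y t / 2) + u2 t * (x t / 2) + u3 t)) (at t within {0..T})"
    if "t \<in> {0..T} - N" for t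
    unfolding x_def[abs_def] y_def[abs_def] z_def[abs_def] has_real_derivative_iff_has_vector_derivative
    using bounded_linear.has_vector_derivative[OF bounded_linear_fst dq[OF that]]
      bounded_linear.has_vector_derivative[OF bounded_linear_fst
        bounded_linear.has_vector_derivative[OF bounded_linear_snd dq[OF that]]]
      bounded_linear.has_vector_derivative[OF bounded_linear_snd
        bounded_linear.has_vector_derivative[OF bounded_linear_snd dq[OF that]]]
    by (auto simp: x_def y_def)
  have lx: "L-lipschitz_on {0..T} x" and ly: "L-lipschitz_on {0..T} y" and lz: "L-lipschitz_on {0..T} z"
    unfolding x_def[abs_def] y_def[abs_def] z_def[abs_def]
    using lip by (auto simp: lipschitz_on_def intro: order_trans[OF dist_fst_le] order_trans[OF dist_snd_le])
  have u_bound: "(u2 t)\<^sup>2 + (u3 t)\<^sup>2 \<le> (u1 t)\<^sup>2" "0 \<le> u1 t" "\<bar>u2 t\<bar> \<le> u1 t" if "t \<in> {0..T}" for t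
  proof -
    show *: "(u2 t)\<^sup>2 + (u3 t)\<^sup>2 \<le> (u1 t)\<^sup>2" "0 \<le> u1 t" using u[OF that] by (auto simp: mem_U_iff)
    then have "(u2 t)\<^sup>2 \<le> (u1 t)\<^sup>2" by (smt (verit) zero_le_power2)
    with * show "\<bar>u2 t\<bar> \<le> u1 t" by (simp add: abs_le_square_iff[symmetric])
  qed
  have zero: "x 0 = 0" "y 0 = 0" "z 0 = 0" using assms(2) by (auto simp: x_def y_def z_def)
  \<comment> \<open>The null coordinates \<open>x + y\<close> and \<open>x - y\<close> have
    velocities \<open>u1 + u2\<close> and \<open>u1 - u2\<close>, both nonnegative on
    \<open>U\<close>.\<close>
  have cone: "\<bar>y t\<bar> \<le> x t" if t: "t \<in> {0..T}" for t
  proof -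
    have sub: "{0..t} \<subseteq> {0..T}" using t by auto
    have "x 0 + s * y 0 \<le> x t + s * y t" if s: "\<bar>s\<bar> = 1" for s
    proof (rule lipschitz_ae_nonneg_deriv_le[where f = "\<lambda>t. x t + s * y t" and a = 0 and b = t, OF _ _ N])
      show "(L + 1 * L)-lipschitz_on {0..t} (\<lambda>t. x t + s * y t)"
        using s by (intro lipschitz_intros lipschitz_on_subset[OF lx sub] lipschitz_on_subset[OF ly sub]) auto
      fix r assume r: "r \<in> {0..t} - N"
      then have r': "r \<in> {0..T} - N" using sub by auto
      have "((\<lambda>t. x t + s * y t) has_real_derivative u1 r + s * u2 r) (at r within {0..T})"
        by (intro DERIV_add DERIV_cmult dx dy r')
      then have "((\<lambda>t. x t + s * y t) has_real_derivative u1 r + s * u2 r) (at r within {0..t})"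
        using sub by (rule DERIV_subset)
      moreover have "u1 r + s * u2 r \<ge> 0" using u_bound(3)[of r] r' s by (auto simp: abs_if split: if_splits)
      ultimately show "\<exists>D\<ge>0. ((\<lambda>t. x t + s * y t) has_vector_derivative D) (at r within {0..t})"
        unfolding has_real_derivative_iff_has_vector_derivative by blast
    qed (use t in auto)
    from this[of 1] this[of "-1"] show ?thesis using zero by auto
  qed
  have fin: "x T = x1" "y T = y1" "z T = z1" using assms(3) by (auto simp: x_def y_def z_def)
  show "\<bar>y1\<bar> \<le> x1" using cone[of T] T fin by simp
  \<comment> \<open>Left translation by \<open>(\<epsilon>, 0, 0)\<close> sends
    \<open>(x, y, z)\<close> to \<open>(x + \<epsilon>, y, z + \<epsilon> * y / 2)\<close> and
    preserves the system. The sign \<open>\<sigma>\<close> treats upper and lower bounds on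
    \<open>z\<close> at once.\<close>
  have eps: "\<sigma> * (z1 + \<epsilon> * y1 / 2) \<le> zmax ((x1 + \<epsilon>)\<^sup>2 - y1\<^sup>2)" if \<epsilon>: "\<epsilon> > 0" and \<sigma>: "\<bar>\<sigma>\<bar> = 1" for \<epsilon> \<sigma> :: real
  proof -
    \<comment> \<open>By \<open>cone\<close> both factors are at least \<open>\<epsilon>\<close>, so
      \<open>\<rho>\<close> stays where \<open>zmax\<close> is Lipschitz.\<close>
    define \<rho> where "\<rho> t = (x t + \<epsilon> + y t) * (x t + \<epsilon> - y t)" for t
    have \<rho>: "\<rho> t = (x t + \<epsilon>)\<^sup>2 - (y t)\<^sup>2" for t by (simp add: \<rho>_def power2_eq_square algebra_simps)
    have \<rho>_ge: "\<epsilon>\<^sup>2 \<le> \<rho> t" if "t \<in> {0..T}" for t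
      unfolding \<rho>_def power2_eq_square using cone[OF that] \<epsilon> by (intro mult_mono) auto
    \<comment> \<open>The slack in the height bound; it starts at
      \<open>zmax (\<epsilon>\<^sup>2)\<close>, which is nonnegative, and never decreases.\<close>
    define g where "g t = zmax (\<rho> t) - \<sigma> * (z t + \<epsilon> * y t / 2)" for t
    have l_sum: "(L + 0 + L)-lipschitz_on {0..T} (\<lambda>t. x t + \<epsilon> + y t)"
      and l_diff: "(L + 0 + L)-lipschitz_on {0..T} (\<lambda>t. x t + \<epsilon> - y t)"
      by (intro lipschitz_intros lx ly)+
    have "compact ((\<lambda>t. x t + \<epsilon> + y t) ` {0..T})" "compact ((\<lambda>t. x t + \<epsilon> - y t) ` {0..T})"
      using l_sum l_diff by (auto intro!: compact_continuous_image lipschitz_on_continuous_on)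
    then have "bounded ((\<lambda>t. x t + \<epsilon> + y t) ` {0..T})" "bounded ((\<lambda>t. x t + \<epsilon> - y t) ` {0..T})"
      by (auto intro: compact_imp_bounded)
    then obtain M where "M-lipschitz_on {0..T} \<rho>"
      unfolding \<rho>_def[abs_def] by (rule lipschitz_on_mult[OF l_sum l_diff])
    then have l_zmax: "(sqrt (1 / (4 * \<epsilon>\<^sup>2) + 1 / 16) * M)-lipschitz_on {0..T} (\<lambda>t. zmax (\<rho> t))"
      using \<epsilon> \<rho>_ge by (intro lipschitz_on_compose2 lipschitz_on_subset[OF zmax_lipschitz_on[of "\<epsilon>\<^sup>2"]]) auto
    have "\<exists>M. M-lipschitz_on {0..T} (\<lambda>t. \<sigma> * (z t + (\<epsilon> / 2) * y t))"
      using lipschitz_on_cmult_real[OF lipschitz_on_add[OF lz lipschitz_on_cmult_real[OF ly, of "\<epsilon> / 2"]], of \<sigma>]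
      by blast
    then obtain M' where "M'-lipschitz_on {0..T} (\<lambda>t. \<sigma> * (z t + (\<epsilon> / 2) * y t))" by blast
    with l_zmax have "(sqrt (1 / (4 * \<epsilon>\<^sup>2) + 1 / 16) * M + M')-lipschitz_on {0..T} g"
      unfolding g_def[abs_def] by (auto intro: lipschitz_on_diff)
    then have "g 0 \<le> g T"
    proof (rule lipschitz_ae_nonneg_deriv_le[OF T _ N])
      fix t assume t: "t \<in> {0..T} - N"
      have pos: "\<rho> t > 0" using \<rho>_ge[of t] t \<epsilon> by (smt (verit) DiffD1 zero_less_power)
      have d\<rho>: "(\<rho> has_real_derivative 2 * ((x t + \<epsilon>) * u1 t - y t * u2 t)) (at t within {0..T})"
        unfolding \<rho>[abs_def] using dx[OF t] dy[OF t]
        by (auto intro!: derivative_eq_intros simp: algebra_simps)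
      define K where "K = sqrt (1 + \<rho> t / 4) / (2 * sqrt (\<rho> t))"
      have "((\<lambda>t. zmax (\<rho> t)) has_real_derivative K * (2 * ((x t + \<epsilon>) * u1 t - y t * u2 t))) (at t within {0..T})"
        unfolding K_def using zmax_has_real_derivative[OF pos, of UNIV] d\<rho> by (rule DERIV_chain2)
      then have "(g has_real_derivative K * (2 * ((x t + \<epsilon>) * u1 t - y t * u2 t))
          - \<sigma> * (((x t + \<epsilon>) * u2 t - y t * u1 t) / 2 + u3 t)) (at t within {0..T})"
        unfolding g_def[abs_def] using dz[OF t] dy[OF t]
        by (auto intro!: derivative_eq_intros simp: field_simps)
      moreover have "\<sigma> * (((x t + \<epsilon>) * u2 t - y t * u1 t) / 2 + u3 t) \<le> K * (2 * ((x t + \<epsilon>) * u1 t - y t * u2 t))"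
        unfolding K_def using cone[of t] u_bound[of t] t \<epsilon> \<sigma> pos
        by (intro hyperbolic_cauchy_schwarz) (auto simp: \<rho>)
      ultimately show "\<exists>D\<ge>0. (g has_vector_derivative D) (at t within {0..T})"
        unfolding has_real_derivative_iff_has_vector_derivative
        by (intro exI[of _ "K * (2 * ((x t + \<epsilon>) * u1 t - y t * u2 t))
            - \<sigma> * (((x t + \<epsilon>) * u2 t - y t * u1 t) / 2 + u3 t)"] conjI)
          (simp_all only: diff_ge_0_iff_ge)
    qed
    moreover have "g 0 \<ge> 0" using zero zmax_nonneg[of "\<epsilon>\<^sup>2"] by (simp add: g_def \<rho>)
    ultimately show ?thesis using fin by (simp add: g_def \<rho>)
  qed
  \<comment> \<open>Passing to the limit \<open>\<epsilon>\<close> to 0 needs only continuity of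
    \<open>zmax\<close>, which also holds at the singular value 0.\<close>
  have "\<sigma> * z1 \<le> zmax (x1\<^sup>2 - y1\<^sup>2)" if \<sigma>: "\<bar>\<sigma>\<bar> = 1" for \<sigma> :: real
  proof (rule tendsto_le)
    show "((\<lambda>\<epsilon>. zmax ((x1 + \<epsilon>)\<^sup>2 - y1\<^sup>2)) \<longlongrightarrow> zmax (x1\<^sup>2 - y1\<^sup>2)) (at_right 0)"
    proof -
      have lim: "((\<lambda>\<epsilon>. (x1 + \<epsilon>)\<^sup>2 - y1\<^sup>2) \<longlongrightarrow> x1\<^sup>2 - y1\<^sup>2) (at_right 0)"
        by (auto intro!: tendsto_eq_intros)
      show ?thesis unfolding zmax_def
        by (intro tendsto_add tendsto_mult tendsto_divide tendsto_arsinh tendsto_real_sqrt tendsto_const lim) simp_all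
    qed
    show "((\<lambda>\<epsilon>. \<sigma> * (z1 + \<epsilon> * y1 / 2)) \<longlongrightarrow> \<sigma> * z1) (at_right 0)"
      by (auto intro!: tendsto_eq_intros)
    show "\<forall>\<^sub>F \<epsilon> in at_right 0. \<sigma> * (z1 + \<epsilon> * y1 / 2) \<le> zmax ((x1 + \<epsilon>)\<^sup>2 - y1\<^sup>2)"
      using eps \<sigma> by (auto simp: eventually_at_right_field intro: exI[of _ 1])
  qed simp
  from this[of 1] this[of "-1"] show "\<bar>z1\<bar> \<le> zmax (x1\<^sup>2 - y1\<^sup>2)" by auto
qed

section \<open>Sufficiency: explicit trajectories from the origin\<close>

text \<open>On a compact interval a continuous control is measurable and bounded, and the velocity
  is continuous, hence bounded, which gives the Lipschitz constant.\<close>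

lemma smooth_admissible_trajectory:
  assumes T: "0 \<le> T" and u: "continuous_on {0..T} u" "\<And>t. t \<in> {0..T} \<Longrightarrow> u t \<in> U"
    and q: "\<And>t. t \<in> {0..T} \<Longrightarrow> (q has_vector_derivative control_field (u t) (q t)) (at t within {0..T})"
  shows "admissible_trajectory T q"
proof -
  have bounded: "\<exists>M\<ge>0. \<forall>t\<in>{0..T}. norm (f t) \<le> M"
    if "continuous_on {0..T} f" for f :: "real \<Rightarrow> point"
  proof -
    have "bounded (f ` {0..T})"
      using compact_continuous_image[OF that] by (intro compact_imp_bounded) simp
    then obtain M where "M > 0" "\<forall>t\<in>{0..T}. norm (f t) \<le> M" unfolding bounded_pos by auto
    then show ?thesis by (intro exI[of _ M]) auto
  qed
  have "continuous_on {0..T} q"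
    unfolding continuous_on_eq_continuous_within using has_vector_derivative_continuous[OF q] by blast
  then have "continuous_on {0..T} (\<lambda>t. control_field (u t) (q t))"
    unfolding control_field_def X1_def X2_def X3_def case_prod_beta
    by (intro continuous_intros u(1)) auto
  then obtain M where M: "M \<ge> 0" "\<And>t. t \<in> {0..T} \<Longrightarrow> norm (control_field (u t) (q t)) \<le> M"
    using bounded[of "\<lambda>t. control_field (u t) (q t)"] by blast
  have "M-lipschitz_on {0..T} q"
  proof (rule bounded_derivative_imp_lipschitz)
    fix t assume t: "t \<in> {0..T}"
    show "(q has_derivative (\<lambda>h. h *\<^sub>R control_field (u t) (q t))) (at t within {0..T})"
      using q[OF t] by (simp add: has_vector_derivative_def)
    show "onorm (\<lambda>h. h *\<^sub>R control_field (u t) (q t)) \<le> M"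
      using M(2)[OF t] by (intro onorm_le) (simp add: mult_left_mono mult.commute[of M])
  qed (use M in auto)
  have "u \<in> borel_measurable (lebesgue_on {0..T})"
    using u(1) by (rule continuous_imp_measurable_on_sets_lebesgue) simp
  moreover obtain M' where "\<And>t. t \<in> {0..T} \<Longrightarrow> norm (u t) \<le> M'"
    using bounded[OF u(1)] by blast
  ultimately have "admissible_control T u"
    using u(2) unfolding admissible_control_def by (intro conjI exI[of _ M'] AE_I2) auto
  moreover have "AE t in lebesgue_on {0..T}.
      (q has_vector_derivative control_field (u t) (q t)) (at t within {0..T})"
    using q by (intro AE_I2) simp
  ultimately show ?thesis
    using T \<open>M-lipschitz_on {0..T} q\<close> unfolding admissible_trajectory_def by blast
qed

lemma attainable_setI:
  "\<lbrakk>admissible_trajectory T q; q 0 = q0; q T = p\<rbrakk> \<Longrightarrow> p \<in> attainable_set q0"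
  unfolding attainable_set_def by blast

text \<open>The endpoint itself serves as constant control for unit time: a ray from the origin
  sweeps no area, so \<open>z\<close> grows by \<open>u3\<close> alone.\<close>

lemma segment_attainable:
  assumes "\<bar>y\<bar> \<le> x" "\<bar>z\<bar> \<le> sqrt (x\<^sup>2 - y\<^sup>2)"
  shows "(x, y, z) \<in> attainable_set (0, 0, 0)"
proof -
  define q where "q s = (s * x, s * y, s * z)" for s
  have "y\<^sup>2 \<le> x\<^sup>2" using assms(1) power_mono[of "\<bar>y\<bar>" x 2] by simp
  then have "z\<^sup>2 \<le> x\<^sup>2 - y\<^sup>2"
    using power_mono[OF assms(2), of 2] by simp
  then have "(x, y, z) \<in> U" using assms(1) by (auto simp: mem_U_iff)
  moreover have "(q has_vector_derivative control_field (x, y, z) (q s)) (at s within {0..1})" for s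
    unfolding q_def[abs_def] control_field_eq
    by (intro has_vector_derivative_Pair; auto intro!: derivative_eq_intros
        simp flip: has_real_derivative_iff_has_vector_derivative)
  ultimately have "admissible_trajectory 1 q"
    by (intro smooth_admissible_trajectory[where u = "\<lambda>_. (x, y, z)"]) auto
  moreover have "q 0 = (0, 0, 0)" "q 1 = (x, y, z)" by (auto simp: q_def)
  ultimately show ?thesis by (rule attainable_setI)
qed

(* z-coordinate at the end of a hyperbolic arc with u3 = 1, chord of Minkowski length r and
   half-angle h; its curvature is 2 sinh h / r, and h = arsinh (r / 2) gives the extremal arc. *)
definition arc_height :: "real \<Rightarrow> real \<Rightarrow> real" where
  "arc_height r h = (sinh (2 * h) - 2 * h) * r\<^sup>2 / (8 * (sinh h)\<^sup>2) + h * r / sinh h"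

text \<open>The planar motion has unit Lorentzian speed, with rapidity starting at \<open>p\<close>
  and growing at rate \<open>k\<close>. The first summand of the height is the area between arc and
  chord, the second the contribution of the constant \<open>u3 = c\<close>.\<close>

lemma hyperbolic_arc_attainable:
  assumes "k \<noteq> 0" "T \<ge> 0" "\<bar>c\<bar> \<le> 1"
  shows "((sinh (k * T + p) - sinh p) / k, (cosh (k * T + p) - cosh p) / k,
      (sinh (k * T) - k * T) / (2 * k\<^sup>2) + c * T) \<in> attainable_set (0, 0, 0)"
proof -
  define q where "q s = ((sinh (k * s + p) - sinh p) / k, (cosh (k * s + p) - cosh p) / k,
      (sinh (k * s) - k * s) / (2 * k\<^sup>2) + c * s)" for s
  define u where "u s = (cosh (k * s + p), sinh (k * s + p), c)" for s
  \<comment> \<open>By the subtraction formula for \<open>cosh\<close> the rate of swept area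
    depends on the turned angle \<open>k * s\<close> only, not on \<open>p\<close>.\<close>
  have dz: "cosh (k * s + p) * (- ((cosh (k * s + p) - cosh p) / k) / 2)
      + sinh (k * s + p) * ((sinh (k * s + p) - sinh p) / k / 2) + c
      = (cosh (k * s) * k - k) / (2 * k\<^sup>2) + c" for s
  proof -
    have "cosh (k * s) = cosh (k * s + p) * cosh p - sinh (k * s + p) * sinh p"
      using cosh_diff[of "k * s + p" p] by simp
    moreover have "(cosh (k * s + p))\<^sup>2 = (sinh (k * s + p))\<^sup>2 + 1" by (rule cosh_square_eq)
    ultimately have "- cosh (k * s + p) * (cosh (k * s + p) - cosh p)
        + sinh (k * s + p) * (sinh (k * s + p) - sinh p) = cosh (k * s) - 1"
      by (simp add: algebra_simps power2_eq_square)
    moreover have "cosh (k * s + p) * (- ((cosh (k * s + p) - cosh p) / k) / 2)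
        + sinh (k * s + p) * ((sinh (k * s + p) - sinh p) / k / 2)
        = (- cosh (k * s + p) * (cosh (k * s + p) - cosh p)
        + sinh (k * s + p) * (sinh (k * s + p) - sinh p)) / (2 * k)"
      by (simp add: add_divide_distrib diff_divide_distrib algebra_simps)
    moreover have "(cosh (k * s) * k - k) / (2 * k\<^sup>2) = (cosh (k * s) - 1) / (2 * k)"
      using assms(1) by (simp add: field_simps power2_eq_square)
    ultimately show ?thesis by simp
  qed
  have "((\<lambda>s. sinh (k * s + p) - sinh p) has_real_derivative cosh (k * s + p) * k) (at s within {0..T})"
    "((\<lambda>s. cosh (k * s + p) - cosh p) has_real_derivative sinh (k * s + p) * k) (at s within {0..T})"
    "((\<lambda>s. sinh (k * s) - k * s) has_real_derivative cosh (k * s) * k - k) (at s within {0..T})"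
    "((\<lambda>s. c * s) has_real_derivative c) (at s within {0..T})" for s
    by (auto intro!: derivative_eq_intros)
  note this(1,2)[THEN DERIV_cdivide, of k] DERIV_add[OF this(3)[THEN DERIV_cdivide, of "2 * k\<^sup>2"] this(4)]
  then have "(q has_vector_derivative control_field (u s) (q s)) (at s within {0..T})" for s
    unfolding q_def[abs_def] u_def control_field_eq dz has_real_derivative_iff_has_vector_derivative
    using assms(1) by (intro has_vector_derivative_Pair) simp_all
  moreover have "continuous_on {0..T} u"
    unfolding u_def[abs_def] by (intro continuous_intros)
  moreover have "u s \<in> U" for s
    using assms(3) unfolding u_def mem_U_iff cosh_square_eq by (auto simp: abs_square_le_1)
  ultimately have "admissible_trajectory T q"
    using assms(2) by (intro smooth_admissible_trajectory[where u = u]) auto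
  moreover have "q 0 = (0, 0, 0)" by (simp add: q_def)
  ultimately show ?thesis by (rule attainable_setI) (simp add: q_def)
qed

lemma arc_height_attainable:
  assumes "r > 0" "h > 0" and \<sigma>: "\<bar>\<sigma>\<bar> = 1"
  shows "(r * cosh p, r * sinh p, \<sigma> * arc_height r h) \<in> attainable_set (0, 0, 0)"
proof -
  \<comment> \<open>Chosen so that the rapidity changes by \<open>2 * \<sigma> * h\<close> in time
    \<open>T\<close> and the chord has Minkowski length \<open>r\<close>.\<close>
  define k T where "k = \<sigma> * (2 * sinh h / r)" and "T = h * r / sinh h"
  have S: "sinh h > 0" using assms by simp
  have \<sigma>': "\<sigma> = 1 \<or> \<sigma> = -1" using \<sigma> by (auto simp: abs_if split: if_splits)
  have k: "k \<noteq> 0" using \<sigma>' S assms by (auto simp: k_def)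
  have T: "T \<ge> 0" using S assms by (simp add: T_def)
  have kT: "k * T = 2 * (\<sigma> * h)" using S assms by (simp add: k_def T_def)
  have sh: "sinh (\<sigma> * h) = \<sigma> * sinh h" "sinh (2 * (\<sigma> * h)) = \<sigma> * sinh (2 * h)" "\<sigma>\<^sup>2 = 1"
    using \<sigma>' by auto
  \<comment> \<open>Starting at rapidity \<open>p - \<sigma> * h\<close> puts the mean rapidity at
    \<open>p\<close>, which is then the direction of the chord.\<close>
  have p1: "sinh (k * T + (p - \<sigma> * h)) - sinh (p - \<sigma> * h) = 2 * sinh (\<sigma> * h) * cosh p"
    using sinh_add[of p "\<sigma> * h"] sinh_diff[of p "\<sigma> * h"] unfolding kT by (simp add: algebra_simps)
  have p2: "cosh (k * T + (p - \<sigma> * h)) - cosh (p - \<sigma> * h) = 2 * sinh (\<sigma> * h) * sinh p"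
    using cosh_add[of p "\<sigma> * h"] cosh_diff[of p "\<sigma> * h"] unfolding kT by (simp add: algebra_simps)
  have k2: "k\<^sup>2 = 4 * (sinh h)\<^sup>2 / r\<^sup>2" using sh(3) by (simp add: k_def power_mult_distrib power_divide)
  have "2 * sinh (\<sigma> * h) * cosh p / k = r * cosh p" "2 * sinh (\<sigma> * h) * sinh p / k = r * sinh p"
    using S assms \<sigma>' unfolding sh(1) by (auto simp: k_def)
  moreover have "(sinh (k * T) - k * T) / (2 * k\<^sup>2) + \<sigma> * T = \<sigma> * arc_height r h"
    unfolding kT k2 sh(2) using assms S unfolding arc_height_def T_def by (simp add: algebra_simps diff_divide_distrib)
  ultimately show ?thesis
    using hyperbolic_arc_attainable[OF k T, of \<sigma> "p - \<sigma> * h"] \<sigma> unfolding p1 p2 by simp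
qed

text \<open>As \<open>h\<close> tends to 0 the arc flattens to its chord: the area vanishes and the
  elapsed time tends to \<open>r\<close>, the largest height of the segment.\<close>

lemma arc_height_tendsto: "r > 0 \<Longrightarrow> ((arc_height r) \<longlongrightarrow> r) (at_right 0)"
  unfolding arc_height_def[abs_def] by real_asymp

text \<open>Here \<open>sinh h = r / 2\<close>, so the curvature is 1 and the two summands become
  \<open>sinh h * cosh h - h\<close> and \<open>2 * h\<close>.\<close>

lemma arc_height_arsinh: "r > 0 \<Longrightarrow> arc_height r (arsinh (r / 2)) = zmax (r\<^sup>2)"
  unfolding arc_height_def zmax_def sinh_double cosh_arsinh_real sinh_arsinh_real
  by (simp add: field_simps power2_eq_square)

lemma arc_height_onto:
  assumes "r > 0" "r < w" "w \<le> zmax (r\<^sup>2)"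
  obtains h where "h > 0" "arc_height r h = w"
proof -
  have "\<forall>\<^sub>F h in at_right 0. arc_height r h < w"
    using arc_height_tendsto[OF assms(1)] assms(2) by (rule order_tendstoD)
  then obtain b where b: "b > 0" "\<And>h. 0 < h \<Longrightarrow> h < b \<Longrightarrow> arc_height r h < w"
    unfolding eventually_at_right_field by auto
  \<comment> \<open>The intermediate value theorem needs a positive left end, since
    \<open>arc_height r\<close> is discontinuous at 0: division by zero gives it the value 0 there,
    while its limit is \<open>r\<close>.\<close>
  define h0 h1 where "h0 = arsinh (r / 2)" and "h1 = min (b / 2) h0"
  have h0: "h0 > 0" using assms(1) by (simp add: h0_def)
  have h1: "h1 > 0" "h1 \<le> h0" "h1 < b" using b(1) h0 by (auto simp: h1_def)
  have "\<exists>h\<ge>h1. h \<le> h0 \<and> arc_height r h = w"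
  proof (rule IVT')
    show "arc_height r h1 \<le> w" using b(2) h1 by (simp add: less_imp_le)
    show "w \<le> arc_height r h0" using assms by (simp add: h0_def arc_height_arsinh)
    show "continuous_on {h1..h0} (arc_height r)"
      unfolding arc_height_def[abs_def] using h1 by (intro continuous_intros) auto
  qed fact
  then obtain h where "h \<ge> h1" "arc_height r h = w" by blast
  then show ?thesis using that[of h] h1(1) by simp
qed

lemma attainable_from_origin:
  assumes "\<bar>y\<bar> \<le> x" "\<bar>z\<bar> \<le> zmax (x\<^sup>2 - y\<^sup>2)"
  shows "(x, y, z) \<in> attainable_set (0, 0, 0)"
proof (cases "\<bar>z\<bar> \<le> sqrt (x\<^sup>2 - y\<^sup>2)")
  case True
  then show ?thesis using assms(1) by (intro segment_attainable)
next
  case False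
  define r where "r = sqrt (x\<^sup>2 - y\<^sup>2)"
  have nonneg: "x\<^sup>2 - y\<^sup>2 \<ge> 0" using assms(1) power_mono[of "\<bar>y\<bar>" x 2] by simp
  \<comment> \<open>On the boundary of the cone \<open>zmax 0 = 0\<close> forces
    \<open>z = 0\<close>, which the segment already covers.\<close>
  have "x\<^sup>2 - y\<^sup>2 \<noteq> 0" using assms(2) False by (auto simp: zmax_def)
  then have r: "r > 0" "r\<^sup>2 = x\<^sup>2 - y\<^sup>2" using nonneg by (auto simp: r_def)
  obtain h where h: "h > 0" "arc_height r h = \<bar>z\<bar>"
    using arc_height_onto[of r "\<bar>z\<bar>"] r assms(2) False unfolding r_def by auto
  \<comment> \<open>The rapidity of \<open>(x, y)\<close> is \<open>arsinh (y / r)\<close>;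
    nonnegativity of \<open>x\<close> selects the right branch of the hyperbola.\<close>
  have "r * cosh (arsinh (y / r)) = sqrt (r\<^sup>2 * ((y / r)\<^sup>2 + 1))"
    using r(1) by (simp add: cosh_arsinh_real real_sqrt_mult)
  also have "r\<^sup>2 * ((y / r)\<^sup>2 + 1) = x\<^sup>2" using r by (simp add: field_simps)
  also have "sqrt (x\<^sup>2) = x" using assms(1) by simp
  finally have "r * cosh (arsinh (y / r)) = x" .
  moreover have "r * sinh (arsinh (y / r)) = y" using r(1) by simp
  moreover have "z \<noteq> 0" using False nonneg by auto
  ultimately show ?thesis
    using arc_height_attainable[OF r(1) h(1), of "sgn z" "arsinh (y / r)"] h(2)
    by (simp add: sgn_mult_abs abs_sgn_eq)
qed

section \<open>The \<open>arcosh\<close> form of the bound and the attainable set\<close>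

text \<open>Half-angle substitution: \<open>t = 2 * a\<close> with
  \<open>sinh a = sqrt \<rho> / 2\<close>, and then
  \<open>(t + sinh t) / 2 = a + sinh a * cosh a\<close>.\<close>

lemma zmax_arcosh:
  assumes "\<rho> \<ge> 0" "t = arcosh ((\<rho> + 2) / 2)"
  shows "(t + sinh t) / 2 = zmax \<rho>"
proof -
  define a where "a = arsinh (sqrt \<rho> / 2)"
  have "cosh (2 * a) = 2 * (sinh a)\<^sup>2 + 1"
    by (simp add: cosh_double cosh_square_eq)
  also have "\<dots> = (\<rho> + 2) / 2" using assms(1) by (simp add: a_def field_simps)
  finally have "cosh (2 * a) = (\<rho> + 2) / 2" .
  moreover have "2 * a \<ge> 0" using assms(1) arsinh_less_iff_real[of "sqrt \<rho> / 2" 0] by (simp add: a_def not_less[symmetric])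
  ultimately have t: "t = 2 * a" using arcosh_cosh_real[of "2 * a"] assms(2) by (simp only:)
  have "cosh a = sqrt (1 + \<rho> / 4)"
    using assms(1) by (simp add: a_def cosh_arsinh_real power_divide add.commute)
  moreover have "sinh a = sqrt \<rho> / 2" by (simp add: a_def)
  ultimately show ?thesis unfolding t sinh_double by (simp add: zmax_def a_def[symmetric])
qed

theorem mainTheorem2:
  shows "attainable_set (0, 0, 0) =
    {(x, y, z) | x y z t.
       0 \<le> x \<and> 1 \<le> (x\<^sup>2 - y\<^sup>2 + 2) / 2 \<and>
       t = arcosh ((x\<^sup>2 - y\<^sup>2 + 2) / 2) \<and>
       0 < \<bar>z\<bar> \<and> \<bar>z\<bar> \<le> (t + sinh t) / 2}
    \<union> {(x, y, z) | x y z. x \<ge> \<bar>y\<bar> \<and> z = 0}"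
  (is "_ = ?A \<union> ?B")
proof -
  \<comment> \<open>The domain of \<open>arcosh\<close> is the double cone
    \<open>y\<^sup>2 \<le> x\<^sup>2\<close>; the sign of \<open>x\<close> selects its future
    half.\<close>
  have cone: "\<bar>y\<bar> \<le> x \<longleftrightarrow> 0 \<le> x \<and> 1 \<le> (x\<^sup>2 - y\<^sup>2 + 2) / 2" for x y :: real
    using abs_le_square_iff[of y x] by auto
  have attainable: "(x, y, z) \<in> attainable_set (0, 0, 0) \<longleftrightarrow> \<bar>y\<bar> \<le> x \<and> \<bar>z\<bar> \<le> zmax (x\<^sup>2 - y\<^sup>2)" for x y z
  proof
    assume "(x, y, z) \<in> attainable_set (0, 0, 0)"
    then obtain q T where "admissible_trajectory T q" "q 0 = (0, 0, 0)" "q T = (x, y, z)"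
      unfolding attainable_set_def by force
    then show "\<bar>y\<bar> \<le> x \<and> \<bar>z\<bar> \<le> zmax (x\<^sup>2 - y\<^sup>2)"
      using attainable_from_origin_bounds by blast
  qed (use attainable_from_origin in blast)
  \<comment> \<open>The two pieces of the union merge: for \<open>z = 0\<close> the height bound is
    automatic because \<open>zmax\<close> is nonnegative on the cone.\<close>
  have described: "(x, y, z) \<in> ?A \<union> ?B \<longleftrightarrow> \<bar>y\<bar> \<le> x \<and> \<bar>z\<bar> \<le> zmax (x\<^sup>2 - y\<^sup>2)" for x y z
  proof (cases "\<bar>y\<bar> \<le> x")
    case True
    then have "x\<^sup>2 - y\<^sup>2 \<ge> 0" by (simp add: cone)
    then show ?thesis
      using True zmax_arcosh[of "x\<^sup>2 - y\<^sup>2", OF _ refl] zmax_nonneg[of "x\<^sup>2 - y\<^sup>2"] cone[of y x]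
      by (cases "z = 0") simp_all
  next
    case False
    then show ?thesis using cone[of y x] by auto
  qed
  show ?thesis
  proof (rule set_eqI)
    fix p :: point
    obtain x y z where "p = (x, y, z)" by (rule prod_cases3)
    then show "p \<in> attainable_set (0, 0, 0) \<longleftrightarrow> p \<in> ?A \<union> ?B"
      by (simp only: attainable described)
  qed
qed

end
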